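(* Let $D\subset\mathbb{R}^3$ be an open set and let $f:D\to\mathbb{R}$ and $g:D\to\mathbb{R}$ be twice continuously differentiable. Let $x^*\in D$ be a critical point for the problem of minimizing $f(x)$ subject to $g(x)=0$, and let $\lambda^*\in\mathbb{R}$ be the corresponding Lagrange multiplier, i.e. $\nabla f(x^* )+\lambda^*\nabla g(x^* )=0$ and $g(x^* )=0$. Define $H=\nabla^2 f(x^* )+\lambda^*\nabla^2 g(x^* )\in\mathbb{R}^{3\times 3}$. Suppose that $\nabla g(x^* )\neq 0$ and take vectors $v_1,v_2\in\mathbb{R}^3$ such that $\mathrm{span}\{v_1,v_2\}=\nabla g(x^* )^\perp$. Consider the matrix $V=(v_1\ v_2)\in\mathbb{R}^{3\times 2}$ whose columns are $v_1,v_2$, and the matrix $A=V^T H V\in\mathbb{R}^{2\times 2}$, with $(1,1)$ entry $a_{11}$. If $a_{11}>0$ and $\det(A)>0$, then $x^*$ is a local minimizer for the problem.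
   Context: The problem is: minimize $f(x)$ subject to $g(x)=0$, with feasible set $\Omega=\{x\in D\mid g(x)=0\}$. A point $x^*\in\Omega$ is a local minimizer of the problem if there exists $\delta>0$ such that $f(x^* )\leq f(x)$ for all $x\in\Omega\cap B(x^*,\delta)$, where $B(x^*,\delta)$ is the Euclidean ball of center $x^*$ and radius $\delta$. Here $\nabla$ denotes the gradient (a column vector), $\nabla^2$ the Hessian matrix, and $w^\perp=\{d\in\mathbb{R}^3\mid w^Td=0\}$. *)

theory Defs
  imports "HOL-Analysis.Analysis"
begin

definition gradient :: "(real^'n \<Rightarrow> real) \<Rightarrow> real^'n \<Rightarrow> real^'n"
  where "gradient f x = (\<chi> i. frechet_derivative f (at x) (axis i 1))"

lemma gderiv_gradient:
  fixes f :: "real^'n \<Rightarrow> real"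
  assumes "f differentiable (at x)"
  shows "GDERIV f x :> gradient f x"
proof -
  have D: "(f has_derivative frechet_derivative f (at x)) (at x)"
    using assms by (simp add: frechet_derivative_works)
  have "frechet_derivative f (at x) h = h \<bullet> gradient f x" for h
  proof -
    have "frechet_derivative f (at x) h =
        frechet_derivative f (at x) (\<Sum>i\<in>UNIV. h $ i *s axis i 1)"
      by (simp add: basis_expansion)
    also have "\<dots> = (\<Sum>i\<in>UNIV. h $ i * frechet_derivative f (at x) (axis i 1))"
      using linear_frechet_derivative[OF assms]
      by (simp add: linear_sum linear_cmul scalar_mult_eq_scaleR)
    finally show ?thesis
      by (simp add: gradient_def inner_vec_def)
  qed
  then have "frechet_derivative f (at x) = (\<lambda>h. h \<bullet> gradient f x)"
    by (rule ext)
  with D show ?thesis by (simp add: gderiv_def)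
qed

text \<open>The entry in row i and column j is the partial derivative with respect to the j-th variable
  of the partial derivative of f with respect to the i-th variable.\<close>

definition hessian :: "(real^'n \<Rightarrow> real) \<Rightarrow> real^'n \<Rightarrow> real^'n^'n"
  where "hessian f x = jacobian (gradient f) (at x)"

text \<open>Meant for an open set D, so that the derivatives at a point of D depend only on the
  values of f on D. Continuity of f and of its gradient follows from their differentiability.\<close>

definition twice_continuously_differentiable_on :: "(real^'n \<Rightarrow> real) \<Rightarrow> (real^'n) set \<Rightarrow> bool"
  where "twice_continuously_differentiable_on f D \<longleftrightarrow>
    (\<forall>x\<in>D. f differentiable (at x)) \<and>
    (\<forall>x\<in>D. gradient f differentiable (at x)) \<and>
    continuous_on D (hessian f)"

definition feasible_set :: "('a \<Rightarrow> real) \<Rightarrow> 'a set \<Rightarrow> 'a set"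
  where "feasible_set g D = {x \<in> D. g x = 0}"

definition local_minimizer ::
    "('a::metric_space \<Rightarrow> real) \<Rightarrow> ('a \<Rightarrow> real) \<Rightarrow> 'a set \<Rightarrow> 'a \<Rightarrow> bool"
  where "local_minimizer f g D x \<longleftrightarrow>
    x \<in> feasible_set g D \<and> (\<exists>\<delta>>0. \<forall>y \<in> feasible_set g D \<inter> ball x \<delta>. f x \<le> f y)"

end

theory Submission
  imports Defs
begin

text \<open>The Hessian H of the Lagrangian is symmetric, so the leading minors of A decide that H is
  positive definite on the tangent plane. If feasible points with smaller objective values
  converged to the critical point, a limit of their normalized displacements would be a unit
  tangent vector d with H d \<bullet> d \<le> 0, by the second-order expansion of the Lagrangian,
  which agrees with the objective on feasible points.\<close>

text \<open>With h = 0 this is Taylor's formula of order two. Splitting the increment in two also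
  yields the symmetry of H, by adding tu and tv in either order.\<close>

lemma second_difference_bound:
  fixes F :: "'a::real_inner \<Rightarrow> real"
  assumes "open S" "x \<in> S" "\<And>y. y \<in> S \<Longrightarrow> GDERIV F y :> G y"
    and G: "(G has_derivative H) (at x)" and "e > 0"
  obtains d where "d > 0"
    "\<And>h k. norm h + norm k < d \<Longrightarrow>
      \<bar>F (x + h + k) - F (x + h) - (G x \<bullet> k + H h \<bullet> k + H k \<bullet> k / 2)\<bar>
        \<le> e * (norm h + norm k) * norm k"
proof -
  obtain d1 where d1: "d1 > 0" "ball x d1 \<subseteq> S"
    using assms(1,2) openE by blast
  obtain d2 where d2: "d2 > 0"
    "\<And>y. norm (y - x) < d2 \<Longrightarrow> norm (G y - G x - H (y - x)) \<le> e * norm (y - x)"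
    using G \<open>e > 0\<close> unfolding has_derivative_at_alt by meson
  have "linear H"
    using G by (rule has_derivative_linear)
  show thesis
  proof (rule that[of "min d1 d2"])
    fix h k :: 'a
    assume hk: "norm h + norm k < min d1 d2"
    \<comment> \<open>Every point of the segment from \<open>x + h\<close> to
      \<open>x + h + k\<close> lies within \<open>norm h + norm k\<close> of \<open>x\<close>. This
      keeps the segment inside \<open>S\<close> (radius \<open>d1\<close>) and inside the region
      where the linear approximation of \<open>G\<close> is \<open>e\<close>-accurate (radius
      \<open>d2\<close>).\<close>
    have small: "norm (h + t *\<^sub>R k) \<le> norm h + norm k" if "0 \<le> t" "t \<le> 1" for t
    proof -
      have "norm (t *\<^sub>R k) \<le> norm k"
        using that by (simp add: mult_left_le_one_le)
      then show ?thesis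
        using norm_triangle_ineq[of h "t *\<^sub>R k"] by linarith
    qed
    \<comment> \<open>\<open>\<phi>\<close> is \<open>F\<close> along the segment minus its
      quadratic model, so \<open>\<phi> 1 - \<phi> 0\<close> is the quantity to estimate. Its
      derivative \<open>\<phi>'\<close> is the first-order remainder of \<open>G\<close> at
      \<open>x\<close>, paired with \<open>k\<close>. The mean value theorem then transfers the
      bound on that remainder to \<open>F\<close>.\<close>
    define \<phi> where
      "\<phi> t = F (x + h + t *\<^sub>R k) - t * (G x \<bullet> k + H h \<bullet> k) - t\<^sup>2 / 2 * (H k \<bullet> k)" for t
    define \<phi>' where "\<phi>' t = (G (x + h + t *\<^sub>R k) - G x - H (h + t *\<^sub>R k)) \<bullet> k" for t
    have deriv: "(\<phi> has_derivative (\<lambda>s. s * \<phi>' t)) (at t)" if t: "0 \<le> t" "t \<le> 1" for t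
    proof -
      have "x + h + t *\<^sub>R k \<in> S"
        using small[OF t] hk d1(2) by (auto simp: subset_iff dist_norm norm_minus_commute add.assoc)
      then have "(F has_derivative (\<lambda>v. v \<bullet> G (x + h + t *\<^sub>R k))) (at (x + h + t *\<^sub>R k))"
        using assms(3) by (simp add: gderiv_def)
      moreover have "((\<lambda>t. x + h + t *\<^sub>R k) has_derivative (\<lambda>s. s *\<^sub>R k)) (at t)"
        by (auto intro!: derivative_eq_intros)
      ultimately have "((\<lambda>t. F (x + h + t *\<^sub>R k)) has_derivative
          (\<lambda>s. (s *\<^sub>R k) \<bullet> G (x + h + t *\<^sub>R k))) (at t)"
        using has_derivative_compose by blast
      then show ?thesis
        unfolding \<phi>_def
        by (auto intro!: derivative_eq_intros simp: fun_eq_iff \<phi>'_def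
            linear_add[OF \<open>linear H\<close>] linear_cmul[OF \<open>linear H\<close>] algebra_simps inner_commute)
    qed
    have "continuous_on {0..1} \<phi>"
      using deriv has_derivative_continuous
      by (intro continuous_at_imp_continuous_on) fastforce
    moreover have "(\<phi> has_derivative (\<lambda>s. s * \<phi>' t)) (at t)" if "0 < t" "t < 1" for t
      using that deriv by simp
    ultimately obtain t where t: "0 < t" "t < 1" "\<phi> 1 - \<phi> 0 = (1 - 0) * \<phi>' t"
      by (rule mvt[OF zero_less_one, of \<phi> "\<lambda>t s. s * \<phi>' t"])
    have "norm (h + t *\<^sub>R k) \<le> norm h + norm k"
      using small t by simp
    moreover from this have "norm (G (x + h + t *\<^sub>R k) - G x - H (h + t *\<^sub>R k))
        \<le> e * norm (h + t *\<^sub>R k)"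
      using d2(2)[of "x + h + t *\<^sub>R k"] hk by (simp add: add.assoc)
    ultimately have "norm (G (x + h + t *\<^sub>R k) - G x - H (h + t *\<^sub>R k)) \<le> e * (norm h + norm k)"
      using \<open>e > 0\<close> by (meson mult_le_cancel_left_pos order_trans)
    then have "\<bar>\<phi>' t\<bar> \<le> e * (norm h + norm k) * norm k"
      unfolding \<phi>'_def by (meson Cauchy_Schwarz_ineq2 mult_right_mono norm_ge_zero order_trans)
    then show "\<bar>F (x + h + k) - F (x + h) - (G x \<bullet> k + H h \<bullet> k + H k \<bullet> k / 2)\<bar>
        \<le> e * (norm h + norm k) * norm k"
      using t(3) by (simp add: \<phi>_def algebra_simps)
  qed (use d1 d2 in auto)
qed

text \<open>Over a small square with sides \<open>t *\<^sub>R u\<close> and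
  \<open>t *\<^sub>R v\<close>, the two paths to the opposite corner give the same total increment
  of \<open>F\<close>. Comparing their expansions leaves only the antisymmetric part of
  \<open>H\<close>, up to an error that is arbitrarily small relative to the square of
  \<open>t\<close>.\<close>

lemma second_derivative_symmetric:
  fixes F :: "'a::real_inner \<Rightarrow> real"
  assumes "open S" "x \<in> S" "\<And>y. y \<in> S \<Longrightarrow> GDERIV F y :> G y"
    and G: "(G has_derivative H) (at x)"
  shows "H u \<bullet> v = H v \<bullet> u"
proof -
  have "linear H"
    using G by (rule has_derivative_linear)
  define N where "N = norm u + norm v"
  have "N \<ge> 0"
    by (simp add: N_def)
  have bound: "\<bar>H u \<bullet> v - H v \<bullet> u\<bar> \<le> 4 * e * N\<^sup>2" if "e > 0" for e
  proof -
    obtain d where d: "d > 0"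
      "\<And>h k. norm h + norm k < d \<Longrightarrow>
        \<bar>F (x + h + k) - F (x + h) - (G x \<bullet> k + H h \<bullet> k + H k \<bullet> k / 2)\<bar>
          \<le> e * (norm h + norm k) * norm k"
      using second_difference_bound[OF assms \<open>e > 0\<close>] by metis
    \<comment> \<open>The \<open>+ 1\<close> avoids division by zero when \<open>u = v = 0\<close>
      and makes \<open>t * N < d\<close> strict.\<close>
    define t where "t = d / (N + 1)"
    have t: "t > 0" "t * N < d"
      using d(1) \<open>N \<ge> 0\<close> by (simp_all add: t_def field_simps)
    \<comment> \<open>By linearity of \<open>H\<close>, the error and all second-order terms carry
      the same factor \<open>t\<^sup>2\<close>, which can later be cancelled.\<close>
    have bound_t: "\<bar>F (x + t *\<^sub>R h + t *\<^sub>R k) - F (x + t *\<^sub>R h)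
        - (t * (G x \<bullet> k) + t\<^sup>2 * (H h \<bullet> k) + t\<^sup>2 * (H k \<bullet> k) / 2)\<bar> \<le> t\<^sup>2 * (e * N\<^sup>2)"
      if "norm h + norm k \<le> N" for h k
    proof -
      have "norm (t *\<^sub>R h) + norm (t *\<^sub>R k) = t * (norm h + norm k)"
        using t by (simp add: algebra_simps)
      also have "\<dots> \<le> t * N"
        using that t by simp
      finally have le: "norm (t *\<^sub>R h) + norm (t *\<^sub>R k) \<le> t * N" .
      then have "norm (t *\<^sub>R k) \<le> t * N"
        using norm_ge_zero[of "t *\<^sub>R h"] by linarith
      then have "(norm (t *\<^sub>R h) + norm (t *\<^sub>R k)) * norm (t *\<^sub>R k) \<le> (t * N) * (t * N)"
        using le t \<open>N \<ge> 0\<close> by (intro mult_mono) auto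
      then have "e * ((norm (t *\<^sub>R h) + norm (t *\<^sub>R k)) * norm (t *\<^sub>R k)) \<le> e * ((t * N) * (t * N))"
        using \<open>e > 0\<close> by (intro mult_left_mono) auto
      moreover have "\<bar>F (x + t *\<^sub>R h + t *\<^sub>R k) - F (x + t *\<^sub>R h)
          - (G x \<bullet> (t *\<^sub>R k) + H (t *\<^sub>R h) \<bullet> (t *\<^sub>R k) + H (t *\<^sub>R k) \<bullet> (t *\<^sub>R k) / 2)\<bar>
        \<le> e * (norm (t *\<^sub>R h) + norm (t *\<^sub>R k)) * norm (t *\<^sub>R k)"
        using le t by (intro d(2)) linarith
      ultimately show ?thesis
        by (simp add: linear_cmul[OF \<open>linear H\<close>] power2_eq_square mult_ac)
    qed
    \<comment> \<open>These are the four sides of the square: \<open>v\<close> after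
      \<open>u\<close>, \<open>u\<close> after \<open>v\<close>, \<open>v\<close> alone and
      \<open>u\<close> alone. In their alternating sum the values of \<open>F\<close>, the gradient
      terms and the diagonal terms \<open>H u \<bullet> u\<close>, \<open>H v \<bullet> v\<close>
      cancel; the four errors add up to the factor 4.\<close>
    have "norm u + norm v \<le> N" "norm v + norm u \<le> N"
      "norm (0::'a) + norm v \<le> N" "norm (0::'a) + norm u \<le> N"
      by (simp_all add: N_def)
    note bounds = this[THEN bound_t]
    have "F (x + t *\<^sub>R v + t *\<^sub>R u) = F (x + t *\<^sub>R u + t *\<^sub>R v)"
      by (simp add: add_ac)
    with bounds have "\<bar>t\<^sup>2 * (H u \<bullet> v) - t\<^sup>2 * (H v \<bullet> u)\<bar> \<le> 4 * (t\<^sup>2 * (e * N\<^sup>2))"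
      unfolding linear_0[OF \<open>linear H\<close>] inner_zero_left mult_zero_right scaleR_zero_right add_0_right
      by linarith
    also have "\<bar>t\<^sup>2 * (H u \<bullet> v) - t\<^sup>2 * (H v \<bullet> u)\<bar> = t\<^sup>2 * \<bar>H u \<bullet> v - H v \<bullet> u\<bar>"
      by (simp add: abs_mult flip: right_diff_distrib)
    finally have "t\<^sup>2 * \<bar>H u \<bullet> v - H v \<bullet> u\<bar> \<le> t\<^sup>2 * (4 * e * N\<^sup>2)"
      by (simp add: mult_ac)
    then show ?thesis
      using t by simp
  qed
  have "\<bar>H u \<bullet> v - H v \<bullet> u\<bar> \<le> 0"
  proof (rule field_le_epsilon)
    fix e :: real
    assume "e > 0"
    then have "4 * (e / (4 * (N\<^sup>2 + 1))) * N\<^sup>2 \<le> e"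
      by (simp add: field_simps add_pos_nonneg)
    moreover have "e / (4 * (N\<^sup>2 + 1)) > 0"
      using \<open>e > 0\<close> by (simp add: add_nonneg_pos)
    ultimately show "\<bar>H u \<bullet> v - H v \<bullet> u\<bar> \<le> 0 + e"
      using bound by fastforce
  qed
  then show ?thesis
    by simp
qed

text \<open>Here \<open>p\<close> is the gradient of the constraint and \<open>G\<close> that of the
  Lagrangian. Finite dimension enters through compactness of the unit sphere, which supplies the
  limit direction.\<close>

lemma second_order_sufficient_condition:
  fixes f g :: "'a::euclidean_space \<Rightarrow> real"
  assumes "open D" "x \<in> D" "g x = 0"
    and g: "GDERIV g x :> p"
    and L: "\<And>y. y \<in> D \<Longrightarrow> GDERIV (\<lambda>y. f y + lam * g y) y :> G y"
    and "G x = 0"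
    and H: "(G has_derivative H) (at x)"
    and pos: "\<And>d. d \<noteq> 0 \<Longrightarrow> p \<bullet> d = 0 \<Longrightarrow> H d \<bullet> d > 0"
  shows "local_minimizer f g D x"
proof (rule ccontr)
  assume "\<not> local_minimizer f g D x"
  then have "\<exists>y. y \<in> D \<and> g y = 0 \<and> dist x y < \<delta> \<and> f y < f x" if "\<delta> > 0" for \<delta>
    using that \<open>x \<in> D\<close> \<open>g x = 0\<close>
    by (fastforce simp: local_minimizer_def feasible_set_def not_le)
  then have "\<forall>n. \<exists>y. y \<in> D \<and> g y = 0 \<and> dist x y < inverse (real (Suc n)) \<and> f y < f x"
    by simp
  then obtain y where y: "\<And>n. y n \<in> D" "\<And>n. g (y n) = 0"
    "\<And>n. dist x (y n) < inverse (real (Suc n))" "\<And>n. f (y n) < f x"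
    by metis
  define h where "h n = y n - x" for n
  define u where "u n = h n /\<^sub>R norm (h n)" for n
  \<comment> \<open>The strict inequality \<open>f (y n) < f x\<close> rules out
    \<open>y n = x\<close>, so normalizing \<open>h n\<close> is legitimate.\<close>
  have h0: "h n \<noteq> 0" for n
    using y(4)[of n] by (auto simp: h_def)
  then have "u n \<in> sphere 0 1" for n
    by (simp add: u_def)
  then obtain d r where d: "d \<in> sphere 0 1" "strict_mono r" "(u \<circ> r) \<longlonglongrightarrow> d"
    using compact_sphere[of "0::'a" 1] unfolding compact_def by metis
  have "h \<longlonglongrightarrow> 0"
  proof (rule Lim_null_comparison[OF _ LIMSEQ_inverse_real_of_nat])
    show "\<forall>\<^sub>F n in sequentially. norm (h n) \<le> inverse (real (Suc n))"
      using y(3) by (auto intro!: always_eventually less_imp_le simp: h_def dist_norm norm_minus_commute)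
  qed
  then have hr: "(h \<circ> r) \<longlonglongrightarrow> 0"
    using d(2) LIMSEQ_subseq_LIMSEQ by blast
  \<comment> \<open>Since \<open>g\<close> vanishes at \<open>x\<close> and at each
    \<open>y n\<close>, its remainder quotient along the sequence is exactly
    \<open>\<bar>p \<bullet> u n\<bar>\<close>. Its limit 0 makes \<open>d\<close> tangent.\<close>
  have "((\<lambda>v. norm (g (x + v) - g x - v \<bullet> p) / norm v) \<longlongrightarrow> 0) (at 0)"
    using g unfolding gderiv_def has_derivative_at by simp
  moreover have "filterlim (h \<circ> r) (at 0) sequentially"
    using hr h0 by (simp add: filterlim_at)
  ultimately have "(\<lambda>n. norm (g (x + (h \<circ> r) n) - g x - (h \<circ> r) n \<bullet> p) / norm ((h \<circ> r) n)) \<longlonglongrightarrow> 0"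
    by (rule filterlim_compose)
  moreover have "norm (g (x + h n) - g x - h n \<bullet> p) / norm (h n) = \<bar>p \<bullet> u n\<bar>" for n
    using y(2)[of n] \<open>g x = 0\<close>
    by (simp add: h_def u_def abs_mult divide_inverse_commute inner_commute)
  ultimately have "(\<lambda>n. \<bar>p \<bullet> (u \<circ> r) n\<bar>) \<longlonglongrightarrow> 0"
    by simp
  moreover have "(\<lambda>n. \<bar>p \<bullet> (u \<circ> r) n\<bar>) \<longlonglongrightarrow> \<bar>p \<bullet> d\<bar>"
    by (intro tendsto_intros d)
  ultimately have "p \<bullet> d = 0"
    using LIMSEQ_unique by force
  moreover have "d \<noteq> 0"
    using d(1) by auto
  ultimately have Hd: "H d \<bullet> d > 0"
    using pos by blast
  \<comment> \<open>The expansion below bounds the form at \<open>u n\<close> by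
    \<open>2 * e\<close>, which for this \<open>e\<close> is half of \<open>H d \<bullet> d\<close>;
    the limit is then contradictory.\<close>
  define e where "e = H d \<bullet> d / 4"
  have "e > 0"
    using Hd by (simp add: e_def)
  obtain \<delta> where \<delta>: "\<delta> > 0"
    "\<And>h k. norm h + norm k < \<delta> \<Longrightarrow>
      \<bar>f (x + h + k) + lam * g (x + h + k) - (f (x + h) + lam * g (x + h))
        - (G x \<bullet> k + H h \<bullet> k + H k \<bullet> k / 2)\<bar> \<le> e * (norm h + norm k) * norm k"
    using second_difference_bound[OF \<open>open D\<close> \<open>x \<in> D\<close> L H \<open>e > 0\<close>] by metis
  have "linear H"
    using H by (rule has_derivative_linear)
  have "H (u n) \<bullet> u n \<le> 2 * e" if "norm (h n) < \<delta>" for n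
  proof -
    \<comment> \<open>This is the Taylor case with zero first increment: feasibility removes the
      \<open>lam\<close> terms and \<open>G x = 0\<close> the linear one.\<close>
    have "\<bar>f (y n) - f x - H (h n) \<bullet> h n / 2\<bar> \<le> e * norm (h n) * norm (h n)"
      using \<delta>(2)[of 0 "h n"] that y(2)[of n] \<open>g x = 0\<close> \<open>G x = 0\<close>
      by (simp add: h_def linear_0[OF \<open>linear H\<close>])
    then have "H (h n) \<bullet> h n \<le> 2 * e * (norm (h n) * norm (h n))"
      using y(4)[of n] by (simp add: mult_ac)
    moreover have "H (u n) \<bullet> u n = H (h n) \<bullet> h n / (norm (h n) * norm (h n))"
      by (simp add: u_def linear_cmul[OF \<open>linear H\<close>] divide_inverse mult_ac)
    ultimately show ?thesis
      using h0[of n] by (simp add: divide_le_eq)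
  qed
  moreover have "\<forall>\<^sub>F n in sequentially. norm ((h \<circ> r) n) < \<delta>"
    using tendstoD[OF hr \<delta>(1)] by simp
  ultimately have "\<forall>\<^sub>F n in sequentially. H ((u \<circ> r) n) \<bullet> (u \<circ> r) n \<le> 2 * e"
    by (auto elim!: eventually_mono)
  moreover have "(\<lambda>n. H ((u \<circ> r) n) \<bullet> (u \<circ> r) n) \<longlonglongrightarrow> H d \<bullet> d"
    using \<open>linear H\<close> d(3)
    by (intro tendsto_inner bounded_linear.tendsto[where f = H])
      (auto simp: linear_conv_bounded_linear comp_def)
  ultimately have "H d \<bullet> d \<le> 2 * e"
    by (intro tendsto_upperbound) auto
  then show False
    using Hd by (simp add: e_def)
qed

text \<open>Complete the square: \<open>a\<close> times the form equals
  \<open>(a * s + b * t)\<^sup>2\<close> plus the determinant times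
  \<open>t\<^sup>2\<close>.\<close>

lemma quadratic_form_2_pos:
  fixes a b c s t :: real
  assumes "a > 0" "a * c - b * b > 0" "s \<noteq> 0 \<or> t \<noteq> 0"
  shows "a * s\<^sup>2 + 2 * b * s * t + c * t\<^sup>2 > 0"
proof -
  have "(a * s + b * t)\<^sup>2 + (a * c - b * b) * t\<^sup>2 > 0"
  proof (cases "t = 0")
    case True
    then show ?thesis using assms by simp
  next
    case False
    then show ?thesis using assms by (intro add_nonneg_pos) auto
  qed
  also have "(a * s + b * t)\<^sup>2 + (a * c - b * b) * t\<^sup>2 = a * (a * s\<^sup>2 + 2 * b * s * t + c * t\<^sup>2)"
    by (simp add: power2_eq_square algebra_simps)
  finally show ?thesis
    using \<open>a > 0\<close> by (simp add: zero_less_mult_iff)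
qed

lemma transpose_mult_mult_entry:
  fixes H :: "real^'n^'n" and V :: "real^'m^'n"
  shows "(transpose V ** H ** V) $ i $ j = column i V \<bullet> (H *v column j V)"
proof -
  have "(transpose V ** H ** V) $ i $ j = ((transpose V ** H ** V) *v axis j 1) $ i"
    by (simp add: matrix_vector_mult_basis column_def)
  also have "\<dots> = (transpose V *v (H *v column j V)) $ i"
    by (simp only: matrix_vector_mult_basis[of V j] flip: matrix_vector_mul_assoc)
  finally show ?thesis
    by (simp add: matrix_vector_mul_component column_def transpose_def del: transpose_matrix_vector)
qed

theorem theorem4p5:
  fixes D :: "(real^3) set"
    and f g :: "real^3 \<Rightarrow> real"
    and xs v1 v2 :: "real^3"
    and lam :: real
    and H :: "real^3^3"
    and V :: "real^2^3"
    and A :: "real^2^2"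
  assumes "open D"
    and "twice_continuously_differentiable_on f D"
    and "twice_continuously_differentiable_on g D"
    and "xs \<in> D"
    and "gradient f xs + lam *\<^sub>R gradient g xs = 0"
    and "g xs = 0"
    and "H = hessian f xs + lam *\<^sub>R hessian g xs"
    and "gradient g xs \<noteq> 0"
    and "span {v1, v2} = {d. gradient g xs \<bullet> d = 0}"
    and "V = transpose (vector [v1, v2])"
    and "A = transpose V ** H ** V"
    and "A $ 1 $ 1 > 0"
    and "det A > 0"
  shows "local_minimizer f g D xs"
proof -
  let ?G = "\<lambda>x. gradient f x + lam *\<^sub>R gradient g x"
  have grad: "GDERIV f x :> gradient f x" "GDERIV g x :> gradient g x" if "x \<in> D" for x
    using that assms(2,3) by (auto simp: twice_continuously_differentiable_on_def gderiv_gradient)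
  have L: "GDERIV (\<lambda>x. f x + lam * g x) x :> ?G x" if "x \<in> D" for x
    using grad[OF that] by (auto simp: gderiv_def inner_add_right intro!: derivative_eq_intros)
  have "(gradient f has_derivative (\<lambda>h. hessian f xs *v h)) (at xs)"
    "(gradient g has_derivative (\<lambda>h. hessian g xs *v h)) (at xs)"
    using \<open>xs \<in> D\<close> assms(2,3)
    by (simp_all add: twice_continuously_differentiable_on_def hessian_def flip: jacobian_works)
  then have H: "(?G has_derivative (\<lambda>h. H *v h)) (at xs)"
    unfolding assms(7)
    by (auto intro!: derivative_eq_intros simp: matrix_vector_mult_add_rdistrib scaleR_matrix_vector_assoc)
  have sym: "(H *v u) \<bullet> v = (H *v v) \<bullet> u" for u v
    using second_derivative_symmetric[OF \<open>open D\<close> \<open>xs \<in> D\<close> L H] .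
  \<comment> \<open>\<open>vector [v1, v2]\<close> lists rows; the transposition in \<open>V\<close>
    turns them into columns.\<close>
  have "column 1 V = v1" "column 2 V = v2"
    by (simp_all add: assms(10) row_def vec_eq_iff)
  then have A: "A $ 1 $ 1 = v1 \<bullet> (H *v v1)" "A $ 1 $ 2 = v1 \<bullet> (H *v v2)"
    "A $ 2 $ 1 = v2 \<bullet> (H *v v1)" "A $ 2 $ 2 = v2 \<bullet> (H *v v2)"
    by (simp_all add: assms(11) transpose_mult_mult_entry)
  \<comment> \<open>Symmetry of \<open>H\<close> makes \<open>det A\<close> equal to
    \<open>a * c - b * b\<close>, the form in which the positivity criterion uses it.\<close>
  have A21: "A $ 2 $ 1 = A $ 1 $ 2"
    using sym[of v1 v2] by (simp add: A inner_commute)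
  have pos: "(H *v d) \<bullet> d > 0" if "d \<noteq> 0" "gradient g xs \<bullet> d = 0" for d
  proof -
    from that(2) have "d \<in> span {v1, v2}"
      by (simp add: assms(9))
    then obtain s t where d: "d = s *\<^sub>R v1 + t *\<^sub>R v2"
      by (auto simp: span_insert span_singleton algebra_simps)
    \<comment> \<open>In the coefficients \<open>s\<close> and \<open>t\<close>, the form of
      \<open>H\<close> on the tangent plane is the form of \<open>A\<close>.\<close>
    have "(H *v d) \<bullet> d = A $ 1 $ 1 * s\<^sup>2 + 2 * A $ 1 $ 2 * s * t + A $ 2 $ 2 * t\<^sup>2"
      using A21
      by (simp add: d A inner_commute power2_eq_square algebra_simps)
    moreover have "s \<noteq> 0 \<or> t \<noteq> 0"
      using d \<open>d \<noteq> 0\<close> by auto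
    ultimately show ?thesis
      using quadratic_form_2_pos[of "A $ 1 $ 1" "A $ 2 $ 2" "A $ 1 $ 2" s t] assms(12,13) A21
      by (simp add: det_2)
  qed
  show ?thesis
    using second_order_sufficient_condition[OF \<open>open D\<close> \<open>xs \<in> D\<close> \<open>g xs = 0\<close> grad(2)[OF \<open>xs \<in> D\<close>]
        L assms(5) H pos] .
qed

end
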